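(* Let $\omega_i=(\alpha_i,\mu_i)$. Suppose that $P(\nu_i>c)\in(0,1)$ for some $c\in\mathbb{R}$ and that $\nu_i$ is independent of $(\alpha_i,\varepsilon_{i1},\varepsilon_{i2},\mu_i,\eta_{i1},\eta_{i2})$. Suppose further that either $P(E[\dot Y_{i2}(0)-\dot Y_{i1}(0)\mid\omega_i]>0)<1$ or $P(E[\dot Y_{i2}(0)-\dot Y_{i1}(0)\mid\omega_i]<0)<1$. Then parallel trends, $E[Y_{i2}(0)-Y_{i1}(0)\mid G_i=1]=E[Y_{i2}(0)-Y_{i1}(0)\mid G_i=0]$, holds for all $g\in\mathcal{G}_\omega$ such that $G_i=g(\omega_i,\nu_i)$ satisfies $P(G_i=1)\in(0,1)$ if and only if $E[\dot Y_{i2}(0)-\dot Y_{i1}(0)\mid\alpha_i,\mu_i]=0$ almost surely.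
   Context: Units are indexed by $i$ (i.i.d. across $i$; all statements are about a generic unit $i$) and periods by $t\in\{1,2\}$. The unobservables $\alpha_i,\varepsilon_{i1},\varepsilon_{i2}$ are finite-dimensional random vectors, $\mu_i,\eta_{i1},\eta_{i2}$ are additional random vectors, and $\nu_i$ is a scalar random variable. The untreated potential outcomes are real-valued and given by $Y_{it}(0)=\xi_t(\alpha_i,\varepsilon_{it})$, $t=1,2$, for arbitrary (measurable) functions $\xi_t$. All relevant moments are assumed to exist (in particular $E|Y_{it}(0)|<\infty$). Notation: $\dot Y_{it}(0)=Y_{it}(0)-E[Y_{it}(0)]$. Let $\mathcal{O}$ and $\mathcal{V}$ be the supports of $\omega_i$ and $\nu_i$; $\mathcal{G}_\omega$ is the class of all (measurable) functions $g:\mathcal{O}\times\mathcal{V}\to\{0,1\}$, called selection mechanisms, and the treatment-group indicator generated by $g$ is $G_i=g(\omega_i,\nu_i)$. The distribution of the unobservables is held fixed as $g$ varies. *)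

theory Defs
  imports "HOL-Probability.Probability"
begin

definition rv_support :: "'w measure \<Rightarrow> ('w \<Rightarrow> 'b::topological_space) \<Rightarrow> 'b set" where
  "rv_support M X = {x. \<forall>U. open U \<longrightarrow> x \<in> U \<longrightarrow> emeasure (distr M borel X) U > 0}"

(* prob_space.indep_var forces both random variables to have the same codomain type. *)
definition indep_rvs ::
    "'w measure \<Rightarrow> ('w \<Rightarrow> 'b::topological_space) \<Rightarrow> ('w \<Rightarrow> 'c::topological_space) \<Rightarrow> bool" where
  "indep_rvs M X Z \<longleftrightarrow>
     prob_space.indep_set M (sets (vimage_algebra (space M) X borel))
                            (sets (vimage_algebra (space M) Z borel))"

definition demeaned :: "'w measure \<Rightarrow> ('w \<Rightarrow> real) \<Rightarrow> 'w \<Rightarrow> real" where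
  "demeaned M Y = (\<lambda>w. Y w - (\<integral>v. Y v \<partial>M))"

(* A version of E[Z | X]. *)
definition cond_exp_rv ::
    "'w measure \<Rightarrow> ('w \<Rightarrow> real) \<Rightarrow> ('w \<Rightarrow> 'b::topological_space) \<Rightarrow> 'w \<Rightarrow> real" where
  "cond_exp_rv M Z X = real_cond_exp M (vimage_algebra (space M) X borel) Z"

(* E[Z | A] for an event A of positive probability. *)
definition cond_exp_event :: "'w measure \<Rightarrow> ('w \<Rightarrow> real) \<Rightarrow> 'w set \<Rightarrow> real" where
  "cond_exp_event M Z A = (LINT w:A|M. Z w) / measure M A"

(* The measurable functions from the product of the supports to {0,1}.  The values of g
   outside the product of the supports are unconstrained. *)
definition selection_mechanisms ::
    "'w measure \<Rightarrow> ('w \<Rightarrow> 'b::topological_space) \<Rightarrow> ('w \<Rightarrow> real) \<Rightarrow> ('b \<times> real \<Rightarrow> nat) set" where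
  "selection_mechanisms M \<omega> \<nu> =
     measurable (restrict_space borel (rv_support M \<omega> \<times> rv_support M \<nu>)) (count_space {0, 1})"

(* G = g(omega, nu).  For random vectors, (omega, nu) lies outside the product of the supports,
   where g carries no information, only with probability zero; G is set to 0 there. *)
definition treatment_group ::
    "'w measure \<Rightarrow> ('w \<Rightarrow> 'b::topological_space) \<Rightarrow> ('w \<Rightarrow> real) \<Rightarrow> ('b \<times> real \<Rightarrow> nat)
      \<Rightarrow> 'w \<Rightarrow> nat" where
  "treatment_group M \<omega> \<nu> g =
     (\<lambda>w. if (\<omega> w, \<nu> w) \<in> rv_support M \<omega> \<times> rv_support M \<nu> then g (\<omega> w, \<nu> w) else 0)"

definition parallel_trends ::
    "'w measure \<Rightarrow> ('w \<Rightarrow> real) \<Rightarrow> ('w \<Rightarrow> real) \<Rightarrow> ('w \<Rightarrow> nat) \<Rightarrow> bool" where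
  "parallel_trends M Y1 Y2 G \<longleftrightarrow>
     cond_exp_event M (\<lambda>w. Y2 w - Y1 w) {w \<in> space M. G w = 1}
     = cond_exp_event M (\<lambda>w. Y2 w - Y1 w) {w \<in> space M. G w = 0}"

end

(* Parallel trends for G says that the demeaned trend D integrates to 0 over {G = 1}. If
   E[D | omega] = 0, then D integrates to 0 over every event {omega in A, nu in B} by independence,
   hence over every event generated by (omega, nu). Conversely, for measurable B the mechanism
   g = 1{omega in B, nu > c} gives 0 = E[D; omega in B] P(nu > c), so D integrates to 0 over every
   event generated by omega. *)

theory Submission
  imports Defs
begin

section \<open>Supports of random vectors\<close>

lemma closed_rv_support: "closed (rv_support M X)"
proof -
  have "- rv_support M X = \<Union>{U. open U \<and> \<not> emeasure (distr M borel X) U > 0}"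
    by (auto simp: rv_support_def)
  also have "open \<dots>"
    by auto
  finally show ?thesis
    by (simp add: closed_def)
qed

text \<open>The complement of the support is the union of all open null sets. By second countability
  countably many of them already cover it, so it is null itself. This is what makes the value of
  \<open>treatment_group\<close> off the supports harmless.\<close>

lemma AE_in_rv_support:
  fixes X :: "'w \<Rightarrow> 'b::second_countable_topology"
  assumes X: "X \<in> borel_measurable M"
  shows "AE w in M. X w \<in> rv_support M X"
proof -
  define \<F> where "\<F> = {U. open U \<and> emeasure (distr M borel X) U = 0}"
  have "- rv_support M X = \<Union>\<F>"
    by (auto simp: rv_support_def \<F>_def)
  moreover obtain \<F>' where \<F>': "\<F>' \<subseteq> \<F>" "countable \<F>'" "\<Union>\<F>' = \<Union>\<F>"
    by (rule Lindelof[of \<F>]) (auto simp: \<F>_def)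
  moreover have "(\<Union>U\<in>\<F>'. U) \<in> null_sets (distr M borel X)"
    by (rule null_sets_UN'[OF \<F>'(2)]) (use \<F>'(1) in \<open>auto simp: \<F>_def null_sets_def\<close>)
  ultimately have "- rv_support M X \<in> null_sets (distr M borel X)"
    by simp
  then have "AE x in distr M borel X. x \<notin> - rv_support M X"
    by (rule AE_not_in)
  then show ?thesis
    using X closed_rv_support[of M X] by (subst (asm) AE_distr_iff) auto
qed

section \<open>Conditional expectation given a random vector\<close>

lemma borel_measurable_subalgebra_vimage:
  assumes "X \<in> borel_measurable M"
  shows "subalgebra M (vimage_algebra (space M) X borel)"
  using sets_image_in_sets[OF refl assms] by (simp add: subalgebra_def)

text \<open>The events generated by \<open>X\<close> are exactly the preimages of Borel sets, so
  this is the defining property of conditional expectation, applied to the candidate version 0. It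
  trades an almost sure statement for integrals over events, the form in which treatment groups
  enter.\<close>

lemma (in prob_space) cond_exp_rv_eq_0_iff:
  fixes X :: "'a \<Rightarrow> 'b::topological_space"
  assumes Z: "integrable M Z" and X: "X \<in> borel_measurable M"
  shows "(AE w in M. cond_exp_rv M Z X w = 0) \<longleftrightarrow>
    (\<forall>B\<in>sets borel. (LINT w:{w \<in> space M. X w \<in> B}|M. Z w) = 0)"
proof -
  let ?F = "vimage_algebra (space M) X borel"
  interpret finite_measure_subalgebra M ?F
    by unfold_locales (rule borel_measurable_subalgebra_vimage[OF X])
  have sets_F: "A \<in> sets ?F \<longleftrightarrow> (\<exists>B\<in>sets borel. A = {w \<in> space M. X w \<in> B})" for A
    by (subst sets_vimage_algebra2) auto
  show ?thesis
  proof (intro iffI ballI)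
    fix B :: "'b set"
    assume ae: "AE w in M. cond_exp_rv M Z X w = 0" and B: "B \<in> sets borel"
    let ?A = "{w \<in> space M. X w \<in> B}"
    have "(LINT w:?A|M. Z w) = (LINT w:?A|M. cond_exp_rv M Z X w)"
      unfolding cond_exp_rv_def using B by (intro real_cond_exp_intA Z) (auto simp: sets_F)
    also have "\<dots> = 0"
      unfolding set_lebesgue_integral_def by (rule integral_eq_zero_AE) (use ae in auto)
    finally show "(LINT w:?A|M. Z w) = 0" .
  next
    assume "\<forall>B\<in>sets borel. (LINT w:{w \<in> space M. X w \<in> B}|M. Z w) = 0"
    then show "AE w in M. cond_exp_rv M Z X w = 0"
      unfolding cond_exp_rv_def
      by (intro real_cond_exp_charact Z) (auto simp: sets_F)
  qed
qed

section \<open>Integrals over events generated by a pair, and independence\<close>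

text \<open>A Dynkin argument: rectangles form an intersection-stable generator, and the sets
  \<open>E\<close> on which the integral vanishes are closed under complements and countable
  disjoint unions. Since \<open>Z\<close> may change sign, the induction runs on the integrals
  directly instead of comparing two measures.\<close>

lemma set_integral_eq_0_pair:
  fixes Z :: "'w \<Rightarrow> real"
  assumes Z: "integrable M Z"
    and X [measurable]: "X \<in> measurable M S" and N [measurable]: "N \<in> measurable M T"
    and rect: "\<And>A B. A \<in> sets S \<Longrightarrow> B \<in> sets T \<Longrightarrow>
      (LINT w:{w \<in> space M. X w \<in> A \<and> N w \<in> B}|M. Z w) = 0"
    and E: "E \<in> sets (S \<Otimes>\<^sub>M T)"
  shows "(LINT w:{w \<in> space M. (X w, N w) \<in> E}|M. Z w) = 0"
proof -
  have pair_sets: "{w \<in> space M. (X w, N w) \<in> E'} \<in> sets M" if "E' \<in> sets (S \<Otimes>\<^sub>M T)" for E'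
  proof -
    have "(\<lambda>w. (X w, N w)) \<in> measurable M (S \<Otimes>\<^sub>M T)"
      by measurable
    from measurable_sets[OF this that] show ?thesis
      by (simp add: vimage_def Int_def conj_commute)
  qed
  have int: "set_integrable M {w \<in> space M. (X w, N w) \<in> E'} Z" if "E' \<in> sets (S \<Otimes>\<^sub>M T)" for E'
    unfolding set_integrable_def by (intro integrable_mult_indicator pair_sets Z that)
  \<comment> \<open>The whole space is the preimage of the largest rectangle. That its integral
    vanishes is what the complement case needs.\<close>
  have total: "(LINT w:space M|M. Z w) = 0"
  proof -
    have "{w \<in> space M. X w \<in> space S \<and> N w \<in> space T} = space M"
      using X[THEN measurable_space] N[THEN measurable_space] by auto
    then show ?thesis
      using rect[of "space S" "space T"] by simp
  qed
  from E[unfolded sets_pair_measure] show ?thesis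
  proof (induction rule: sigma_sets_induct_disjoint[OF Int_stable_pair_measure_generator
        pair_measure_closed, consumes 1, case_names basic empty compl union])
    case (basic E)
    then show ?case
      using rect by auto
  next
    case empty
    then show ?case
      by (simp add: set_lebesgue_integral_def)
  next
    case (compl E)
    then have E: "E \<in> sets (S \<Otimes>\<^sub>M T)"
      by (simp add: sets_pair_measure)
    have eq: "{w \<in> space M. (X w, N w) \<in> space S \<times> space T - E}
        \<union> {w \<in> space M. (X w, N w) \<in> E} = space M"
      using X[THEN measurable_space] N[THEN measurable_space] by auto
    have "space S \<times> space T - E \<in> sets (S \<Otimes>\<^sub>M T)"
      using sets.compl_sets[OF E] by (simp add: space_pair_measure)
    from set_integral_Un[OF _ int[OF this] int[OF E]] show ?case
      using compl.IH total unfolding eq by auto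
  next
    case (union E)
    then have E: "\<And>i. E i \<in> sets (S \<Otimes>\<^sub>M T)"
      by (auto simp: sets_pair_measure)
    have eq: "{w \<in> space M. (X w, N w) \<in> (\<Union>i. E i)} = (\<Union>i. {w \<in> space M. (X w, N w) \<in> E i})"
      by auto
    have "(LINT w:(\<Union>i. {w \<in> space M. (X w, N w) \<in> E i})|M. Z w)
        = (\<Sum>i. LINT w:{w \<in> space M. (X w, N w) \<in> E i}|M. Z w)"
    proof (rule lebesgue_integral_countable_add)
      show "{w \<in> space M. (X w, N w) \<in> E i} \<in> sets M" for i
        by (rule pair_sets[OF E])
      show "set_integrable M (\<Union>i. {w \<in> space M. (X w, N w) \<in> E i}) Z"
        using int[OF sets.countable_nat_UN[of E]] E unfolding eq by blast
      show "{w \<in> space M. (X w, N w) \<in> E i} \<inter> {w \<in> space M. (X w, N w) \<in> E j} = {}"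
        if "i \<noteq> j" for i j
        using union(1) that unfolding disjoint_family_on_def by blast
    qed
    then show ?case
      unfolding eq using union.IH by simp
  qed
qed

text \<open>The integrand on the left is a real function of \<open>W\<close> times the indicator of
  an event of \<open>N\<close>, and the expectation of a product of independent integrable variables
  factors. Passing to these real functions also gives both factors the common value type that
  \<open>indep_var\<close> asks for.\<close>

lemma (in prob_space) indep_rvs_set_integral:
  fixes \<phi> :: "'c::topological_space \<Rightarrow> real"
  assumes indep: "indep_rvs M N W"
    and N [measurable]: "N \<in> borel_measurable M" and W [measurable]: "W \<in> borel_measurable M"
    and \<phi> [measurable]: "\<phi> \<in> borel_measurable borel" and int: "integrable M (\<lambda>w. \<phi> (W w))"
    and A [measurable]: "A \<in> sets borel" and B [measurable]: "B \<in> sets borel"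
  shows "(LINT w:{w \<in> space M. W w \<in> A \<and> N w \<in> B}|M. \<phi> (W w)) =
    (LINT w:{w \<in> space M. W w \<in> A}|M. \<phi> (W w)) * \<P>(w in M. N w \<in> B)"
proof -
  let ?X = "\<lambda>w. indicator A (W w) * \<phi> (W w)" and ?Y = "\<lambda>w. indicat_real B (N w)"
  \<comment> \<open>A Borel function of \<open>V\<close> generates no more events than
    \<open>V\<close> does, so independence descends from \<open>N\<close> and \<open>W\<close> to
    \<open>?Y\<close> and \<open>?X\<close>.\<close>
  have sub: "sigma_sets (space M) {(\<lambda>w. f (V w)) -` C \<inter> space M |C. C \<in> sets borel}
      \<subseteq> sets (vimage_algebra (space M) V borel)"
    if [measurable]: "f \<in> borel_measurable borel"
    for f :: "'x::topological_space \<Rightarrow> real" and V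
    unfolding sets_vimage_algebra[symmetric]
    by (rule sets_image_in_sets)
      (auto intro!: measurable_compose[OF measurable_vimage_algebra1])
  have "indep_var borel ?Y borel ?X"
    unfolding indep_var_eq
  proof (intro conjI)
    show "indep_set
        (sigma_sets (space M) {(\<lambda>w. ?Y w) -` C \<inter> space M |C. C \<in> sets borel})
        (sigma_sets (space M) {(\<lambda>w. ?X w) -` C \<inter> space M |C. C \<in> sets borel})"
      (is "indep_set ?\<Y> ?\<X>")
    proof -
      have "?\<Y> \<subseteq> sets (vimage_algebra (space M) N borel)"
        by (rule sub) measurable
      moreover have "?\<X> \<subseteq> sets (vimage_algebra (space M) W borel)"
        by (rule sub) measurable
      ultimately show ?thesis
        using indep unfolding indep_rvs_def indep_sets2_eq by blast
    qed
  qed measurable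
  moreover have "integrable M ?X"
  proof -
    have "integrable M (\<lambda>w. indicat_real {w \<in> space M. W w \<in> A} w *\<^sub>R \<phi> (W w))"
      by (intro integrable_mult_indicator int) measurable
    also have "?this \<longleftrightarrow> integrable M ?X"
      by (intro Bochner_Integration.integrable_cong) (auto simp: indicator_def)
    finally show ?thesis .
  qed
  moreover have "integrable M ?Y"
    by (intro integrable_const_bound[of _ 1] AE_I2) (auto simp: indicator_def)
  ultimately have "(\<integral>w. ?Y w * ?X w \<partial>M) = (\<integral>w. ?Y w \<partial>M) * (\<integral>w. ?X w \<partial>M)"
    by (intro indep_var_lebesgue_integral)
  also have "(\<integral>w. ?Y w \<partial>M) = (\<integral>w. indicator {w \<in> space M. N w \<in> B} w \<partial>M)"
    by (rule Bochner_Integration.integral_cong) (auto simp: indicator_def)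
  also have "\<dots> = \<P>(w in M. N w \<in> B)"
    by simp
  also have "(\<integral>w. ?X w \<partial>M) = (LINT w:{w \<in> space M. W w \<in> A}|M. \<phi> (W w))"
    unfolding set_lebesgue_integral_def
    by (rule Bochner_Integration.integral_cong) (auto simp: indicator_def)
  also have "(\<integral>w. ?Y w * ?X w \<partial>M) =
      (LINT w:{w \<in> space M. W w \<in> A \<and> N w \<in> B}|M. \<phi> (W w))"
    unfolding set_lebesgue_integral_def
    by (rule Bochner_Integration.integral_cong) (auto simp: indicator_def)
  finally show ?thesis
    by (simp add: mult.commute)
qed

text \<open>Let p be the treatment probability, m the overall mean trend and I the integral of the
  trend over the treated. Parallel trends reads I / p = (m - I) / (1 - p). As 0 < p < 1, clearing
  denominators leaves I = p m, and I - p m is the integral of the demeaned trend over the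
  treated.\<close>

lemma (in prob_space) parallel_trends_iff:
  assumes Y: "integrable M Y1" "integrable M Y2"
    and A: "{w \<in> space M. G w = 1} \<in> sets M" and G: "\<And>w. w \<in> space M \<Longrightarrow> G w \<in> {0, 1}"
    and p: "\<P>(w in M. G w = 1) \<in> {0<..<1}"
  shows "parallel_trends M Y1 Y2 G \<longleftrightarrow>
    (LINT w:{w \<in> space M. G w = 1}|M. demeaned M Y2 w - demeaned M Y1 w) = 0"
proof -
  let ?A = "{w \<in> space M. G w = 1}" and ?B = "{w \<in> space M. G w = 0}"
  let ?D = "\<lambda>w. Y2 w - Y1 w" and ?m = "(\<integral>w. Y2 w \<partial>M) - (\<integral>w. Y1 w \<partial>M)"
  let ?p = "measure M ?A"
  \<comment> \<open>Since \<open>G\<close> takes only the values 0 and 1, the untreated are the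
    complement of the treated.\<close>
  have B: "?B = space M - ?A"
    using G by auto
  have D: "integrable M ?D"
    using Y by auto
  have int: "set_integrable M C ?D" if "C \<in> sets M" for C
    using that D unfolding set_integrable_def by (rule integrable_mult_indicator)
  have "(LINT w:?A \<union> ?B|M. ?D w) = (LINT w:?A|M. ?D w) + (LINT w:?B|M. ?D w)"
    using A by (intro set_integral_Un int) (auto simp: B)
  moreover have "?A \<union> ?B = space M"
    using B by blast
  ultimately have sum: "(LINT w:?B|M. ?D w) = ?m - (LINT w:?A|M. ?D w)"
    using Y D by (simp add: set_integral_space)
  have "(LINT w:?A|M. demeaned M Y2 w - demeaned M Y1 w) = (LINT w:?A|M. ?D w - ?m)"
    by (simp add: demeaned_def algebra_simps)
  also have "\<dots> = (LINT w:?A|M. ?D w) - (LINT w:?A|M. ?m)"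
    using integrable_mult_indicator[OF A, of "\<lambda>_. ?m"]
    by (intro set_integral_diff(2)[OF int[OF A]]) (simp only: set_integrable_def integrable_const)
  also have "(LINT w:?A|M. ?m) = ?p * ?m"
    using A by (simp add: set_lebesgue_integral_def)
  finally have dem: "(LINT w:?A|M. demeaned M Y2 w - demeaned M Y1 w)
      = (LINT w:?A|M. ?D w) - ?p * ?m" .
  have "parallel_trends M Y1 Y2 G \<longleftrightarrow>
      (LINT w:?A|M. ?D w) / ?p = (?m - (LINT w:?A|M. ?D w)) / (1 - ?p)"
    unfolding parallel_trends_def cond_exp_event_def sum using A by (simp add: B prob_compl)
  also have "\<dots> \<longleftrightarrow> (LINT w:?A|M. ?D w) = ?p * ?m"
    using p by (auto simp: field_simps)
  finally show ?thesis
    unfolding dem by simp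
qed


section \<open>Parallel trends under all selection mechanisms\<close>

theorem corollary3p6:
  fixes M :: "'w measure"
    and \<alpha> :: "'w \<Rightarrow> 'a::euclidean_space"
    and \<epsilon>1 :: "'w \<Rightarrow> 'e1::euclidean_space"
    and \<epsilon>2 :: "'w \<Rightarrow> 'e2::euclidean_space"
    and \<mu> :: "'w \<Rightarrow> 'm::euclidean_space"
    and \<eta>1 :: "'w \<Rightarrow> 'h1::euclidean_space"
    and \<eta>2 :: "'w \<Rightarrow> 'h2::euclidean_space"
    and \<nu> :: "'w \<Rightarrow> real"
    and \<xi>1 :: "'a \<times> 'e1 \<Rightarrow> real"
    and \<xi>2 :: "'a \<times> 'e2 \<Rightarrow> real"
    and Y1 Y2 :: "'w \<Rightarrow> real"
    and \<omega> :: "'w \<Rightarrow> 'a \<times> 'm"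
  assumes prob: "prob_space M"
    and rv: "\<alpha> \<in> borel_measurable M" "\<epsilon>1 \<in> borel_measurable M" "\<epsilon>2 \<in> borel_measurable M"
      "\<mu> \<in> borel_measurable M" "\<eta>1 \<in> borel_measurable M" "\<eta>2 \<in> borel_measurable M"
      "\<nu> \<in> borel_measurable M"
    and xi: "\<xi>1 \<in> borel_measurable borel" "\<xi>2 \<in> borel_measurable borel"
    and Y1: "Y1 = (\<lambda>w. \<xi>1 (\<alpha> w, \<epsilon>1 w))"
    and Y2: "Y2 = (\<lambda>w. \<xi>2 (\<alpha> w, \<epsilon>2 w))"
    and moments: "integrable M Y1" "integrable M Y2"
    and omega: "\<omega> = (\<lambda>w. (\<alpha> w, \<mu> w))"
    and nu_nondegenerate: "\<exists>c::real. \<P>(w in M. \<nu> w > c) \<in> {0<..<1}"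
    and nu_indep: "indep_rvs M \<nu> (\<lambda>w. (\<alpha> w, \<epsilon>1 w, \<epsilon>2 w, \<mu> w, \<eta>1 w, \<eta>2 w))"
    and sign:
      "\<P>(w in M. cond_exp_rv M (\<lambda>v. demeaned M Y2 v - demeaned M Y1 v) \<omega> w > 0) < 1
       \<or> \<P>(w in M. cond_exp_rv M (\<lambda>v. demeaned M Y2 v - demeaned M Y1 v) \<omega> w < 0) < 1"
  shows "(\<forall>g \<in> selection_mechanisms M \<omega> \<nu>.
            \<P>(w in M. treatment_group M \<omega> \<nu> g w = 1) \<in> {0<..<1} \<longrightarrow>
            parallel_trends M Y1 Y2 (treatment_group M \<omega> \<nu> g))
     \<longleftrightarrow> (AE w in M. cond_exp_rv M (\<lambda>v. demeaned M Y2 v - demeaned M Y1 v)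
                          (\<lambda>v. (\<alpha> v, \<mu> v)) w = 0)"
proof -
  interpret prob_space M by (rule prob)
  note rv [measurable] and xi [measurable]
  define D where "D = (\<lambda>w. demeaned M Y2 w - demeaned M Y1 w)"
  define W where "W = (\<lambda>w. (\<alpha> w, \<epsilon>1 w, \<epsilon>2 w, \<mu> w, \<eta>1 w, \<eta>2 w))"
  define m where "m = (\<integral>w. Y2 w \<partial>M) - (\<integral>w. Y1 w \<partial>M)"
  \<comment> \<open>The trend depends on the shocks as well as on \<open>\<omega>\<close>, so it is
    written as a function of the full vector \<open>W\<close>, of which \<open>\<nu>\<close> is
    independent. The variable \<open>x\<close> collects the components that do not enter the
    trend.\<close>
  define \<phi> :: "'a \<times> 'e1 \<times> 'e2 \<times> 'm \<times> 'h1 \<times> 'h2 \<Rightarrow> real"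
    where "\<phi> = (\<lambda>(a, e1, e2, x). \<xi>2 (a, e2) - \<xi>1 (a, e1) - m)"
  have \<phi> [measurable]: "\<phi> \<in> borel_measurable borel"
    unfolding \<phi>_def borel_prod[symmetric] by measurable
  have W [measurable]: "W \<in> borel_measurable M"
    unfolding W_def by measurable
  have \<omega> [measurable]: "\<omega> \<in> borel_measurable M"
    unfolding omega by measurable
  have D_\<phi>: "D = (\<lambda>w. \<phi> (W w))"
    by (auto simp: D_def \<phi>_def W_def m_def Y1 Y2 demeaned_def)
  have D_int: "integrable M D"
    using moments by (simp add: D_def demeaned_def)

  \<comment> \<open>The projection \<open>\<pi>\<close> turns an event about \<open>\<omega>\<close>
    into an event about \<open>W\<close>, which allows the independence lemma to split off the
    probability of the \<open>\<nu>\<close> event.\<close>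
  have factor: "(LINT w:{w \<in> space M. \<omega> w \<in> B \<and> \<nu> w \<in> C}|M. D w) =
      (LINT w:{w \<in> space M. \<omega> w \<in> B}|M. D w) * \<P>(w in M. \<nu> w \<in> C)"
    if B [measurable]: "B \<in> sets borel" and C: "C \<in> sets borel" for B C
  proof -
    define \<pi> :: "'a \<times> 'e1 \<times> 'e2 \<times> 'm \<times> 'h1 \<times> 'h2 \<Rightarrow> 'a \<times> 'm"
      where "\<pi> = (\<lambda>(a, e1, e2, u, x). (a, u))"
    have [measurable]: "\<pi> \<in> borel_measurable borel"
      unfolding \<pi>_def borel_prod[symmetric] by measurable
    have "\<pi> -` B \<in> sets borel"
      using measurable_sets[of \<pi> borel borel B] by simp
    moreover have "\<omega> w \<in> B \<longleftrightarrow> W w \<in> \<pi> -` B" for w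
      by (simp add: omega W_def \<pi>_def)
    ultimately show ?thesis
      using indep_rvs_set_integral[OF nu_indep[folded W_def] rv(7) W \<phi> _ _ C, of "\<pi> -` B"]
        D_int by (simp only: D_\<phi>)
  qed

  let ?S = "rv_support M \<omega> \<times> rv_support M \<nu>"
  have S: "?S \<in> sets borel"
    by (intro borel_closed closed_Times closed_rv_support)
  \<comment> \<open>The default value 0 off the supports makes this an exact equality of events,
    with no null set to correct for.\<close>
  have treated: "{w \<in> space M. treatment_group M \<omega> \<nu> g w = 1}
      = {w \<in> space M. (\<omega> w, \<nu> w) \<in> {x \<in> ?S. g x = 1}}" for g
    by (auto simp: treatment_group_def)
  \<comment> \<open>A mechanism is measurable only relative to \<open>?S\<close>. Because
    \<open>?S\<close> is closed, its relatively measurable subsets are Borel in the whole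
    product.\<close>
  have g_sets: "{x \<in> ?S. g x = 1} \<in> sets (borel \<Otimes>\<^sub>M borel)"
    if g: "g \<in> selection_mechanisms M \<omega> \<nu>" for g
  proof -
    have "g -` {1} \<inter> space (restrict_space borel ?S) \<in> sets (restrict_space borel ?S)"
      using g unfolding selection_mechanisms_def by (rule measurable_sets) simp
    also have "g -` {1} \<inter> space (restrict_space borel ?S) = {x \<in> ?S. g x = 1}"
      by (auto simp: space_restrict_space)
    finally show ?thesis
      using S by (subst borel_prod) (simp add: sets_restrict_space_iff)
  qed
  have treated_sets: "{w \<in> space M. treatment_group M \<omega> \<nu> g w = 1} \<in> sets M"
    if g: "g \<in> selection_mechanisms M \<omega> \<nu>" for g
  proof -
    have "(\<lambda>w. (\<omega> w, \<nu> w)) \<in> measurable M (borel \<Otimes>\<^sub>M borel)"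
      by measurable
    from measurable_sets[OF this g_sets[OF g]] show ?thesis
      unfolding treated by (simp add: vimage_def Int_def conj_commute)
  qed
  have PT: "parallel_trends M Y1 Y2 (treatment_group M \<omega> \<nu> g) \<longleftrightarrow>
      (LINT w:{w \<in> space M. treatment_group M \<omega> \<nu> g w = 1}|M. D w) = 0"
    if g: "g \<in> selection_mechanisms M \<omega> \<nu>"
      and p: "\<P>(w in M. treatment_group M \<omega> \<nu> g w = 1) \<in> {0<..<1}" for g
    unfolding D_def
  proof (rule parallel_trends_iff[OF moments _ _ p])
    show "{w \<in> space M. treatment_group M \<omega> \<nu> g w = 1} \<in> sets M"
      using g by (rule treated_sets)
    show "treatment_group M \<omega> \<nu> g w \<in> {0, 1}" for w
      using measurable_space[OF g[unfolded selection_mechanisms_def], of "(\<omega> w, \<nu> w)"]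
      by (auto simp: treatment_group_def space_restrict_space)
  qed

  have "(\<forall>g \<in> selection_mechanisms M \<omega> \<nu>.
            \<P>(w in M. treatment_group M \<omega> \<nu> g w = 1) \<in> {0<..<1} \<longrightarrow>
            parallel_trends M Y1 Y2 (treatment_group M \<omega> \<nu> g))
     \<longleftrightarrow> (\<forall>B\<in>sets borel. (LINT w:{w \<in> space M. \<omega> w \<in> B}|M. D w) = 0)"
    (is "?all \<longleftrightarrow> ?zero")
  proof
    assume zero: ?zero
    show ?all
    proof (intro ballI impI)
      fix g assume g: "g \<in> selection_mechanisms M \<omega> \<nu>"
        and p: "\<P>(w in M. treatment_group M \<omega> \<nu> g w = 1) \<in> {0<..<1}"
      \<comment> \<open>By \<open>factor\<close> and the assumption, the integral vanishes on all
        rectangles. The Dynkin lemma extends this to the treated event.\<close>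
      have "(LINT w:{w \<in> space M. (\<omega> w, \<nu> w) \<in> {x \<in> ?S. g x = 1}}|M. D w) = 0"
        by (rule set_integral_eq_0_pair[OF D_int \<omega> rv(7) _ g_sets[OF g]])
          (use zero factor in auto)
      then show "parallel_trends M Y1 Y2 (treatment_group M \<omega> \<nu> g)"
        unfolding PT[OF g p] treated .
    qed
  next
    assume all: ?all
    show ?zero
    proof
      fix B :: "('a \<times> 'm) set" assume B [measurable]: "B \<in> sets borel"
      obtain c where c: "\<P>(w in M. \<nu> w \<in> {c<..}) \<in> {0<..<1}"
        using nu_nondegenerate by auto
      \<comment> \<open>\<open>B\<close> is the event to be tested. The cutoff \<open>c\<close>
        keeps a positive fraction of units untreated even when \<open>B\<close> has probability
        1.\<close>
      define g :: "('a \<times> 'm) \<times> real \<Rightarrow> nat" where "g = (\<lambda>x. if x \<in> B \<times> {c<..} then 1 else 0)"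
      have g: "g \<in> selection_mechanisms M \<omega> \<nu>"
      proof -
        have "B \<times> {c<..} \<in> sets borel"
          unfolding borel_prod[where 'a="'a \<times> 'm" and 'b=real, symmetric]
          by (intro pair_measureI B) simp
        then have "g \<in> measurable borel (count_space {0, 1})"
          unfolding g_def by (intro measurable_If_set) auto
        then show ?thesis
          unfolding selection_mechanisms_def by (rule measurable_restrict_space1)
      qed
      let ?G = "{w \<in> space M. treatment_group M \<omega> \<nu> g w = 1}"
        and ?R = "{w \<in> space M. \<omega> w \<in> B \<and> \<nu> w \<in> {c<..}}"
      have G: "?G \<in> sets M"
        using g by (rule treated_sets)
      \<comment> \<open>The two events can differ only where \<open>\<omega>\<close> or
        \<open>\<nu>\<close> leaves its support, which has probability 0.\<close>
      have ae: "AE w in M. w \<in> ?G \<longleftrightarrow> w \<in> ?R"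
        using AE_in_rv_support[OF \<omega>] AE_in_rv_support[OF rv(7)]
        by eventually_elim (auto simp: treatment_group_def g_def)
      have int_eq: "(LINT w:?G|M. D w) = (LINT w:?R|M. D w)"
        using D_int G ae unfolding set_lebesgue_integral_def
        by (intro integral_cong_AE) (auto simp: indicator_def)
      have p: "measure M ?G = measure M ?R"
        using ae G by (intro finite_measure_eq_AE) auto
      have "measure M ?G < 1"
      proof -
        have "measure M ?R \<le> \<P>(w in M. \<nu> w \<in> {c<..})"
          by (intro finite_measure_mono) auto
        then show ?thesis
          using c p by auto
      qed
      show "(LINT w:{w \<in> space M. \<omega> w \<in> B}|M. D w) = 0"
      proof (cases "measure M ?G > 0")
        case True
        with \<open>measure M ?G < 1\<close> have "measure M ?G \<in> {0<..<1}"
          by simp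
        from all[rule_format, OF g this] have "(LINT w:?G|M. D w) = 0"
          using PT[OF g \<open>measure M ?G \<in> {0<..<1}\<close>] by simp
        \<comment> \<open>By \<open>factor\<close> the integral over \<open>?R\<close> is the wanted
          integral times the probability of exceeding \<open>c\<close>. That probability is positive
          and cancels.\<close>
        then show ?thesis
          unfolding int_eq factor[OF B borel_open[OF open_greaterThan]] using c by auto
      next
        case False
        then have "measure M ?R = 0"
          using p measure_nonneg[of M ?G] by linarith
        then have "AE w in M. w \<notin> ?R"
          by (subst (asm) prob_eq_0) auto
        then have "(LINT w:?R|M. D w) = 0"
          unfolding set_lebesgue_integral_def by (intro integral_eq_zero_AE) auto
        then show ?thesis
          unfolding factor[OF B borel_open[OF open_greaterThan]] using c by auto
      qed
    qed
  qed
  then show ?thesis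
    using cond_exp_rv_eq_0_iff[OF D_int \<omega>] by (simp add: D_def omega)
qed

end
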